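(* Suppose $X$ is a Banach space which contains, for each $n \in \mathbb{N}$ and $\epsilon > 0$, a linear subspace $Z$ such that $d(Z,\ell_\infty^n) \leq 1+\epsilon$. Suppose that $Y$ is a finite metric space which is concave. Then $X$ contains an isometric copy of $Y$, i.e. there is a distance-preserving map $Y \to X$.
   Context: Banach spaces are over $\mathbb{R}$, and $\ell_\infty^n$ is $\mathbb{R}^n$ with the supremum norm. For Banach spaces $Z, W$, the Banach–Mazur distance is $d(Z,W) = \inf\{\|T\|\,\|T^{-1}\| : T \text{ is an isomorphism from } Z \text{ to } W\}$. A metric space $(Y,d_Y)$ is concave if the triangle inequality is always strict: for all triples of pairwise distinct points $x,y,z \in Y$, $d_Y(x,y) + d_Y(y,z) > d_Y(x,z)$. *)

theory Defs
  imports "HOL-Analysis.Analysis"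
begin

text \<open>
  Normed spaces are represented by linear subspaces of normed vector space types, with the
  inherited norm; maps between them are only considered on the subspace.
\<close>

definition bounded_linear_on ::
  "'a::real_normed_vector set \<Rightarrow> ('a \<Rightarrow> 'b::real_normed_vector) \<Rightarrow> bool" where
  "bounded_linear_on Z T \<longleftrightarrow>
     (\<forall>x\<in>Z. \<forall>y\<in>Z. T (x + y) = T x + T y) \<and>
     (\<forall>c. \<forall>x\<in>Z. T (c *\<^sub>R x) = c *\<^sub>R T x) \<and>
     (\<exists>K. \<forall>x\<in>Z. norm (T x) \<le> norm x * K)"

text \<open>
  The relative version of \<^const>\<open>onorm\<close>. As there, \<open>x = 0\<close> contributes the quotient \<open>0\<close>, so the
  operator norm on the zero space is \<open>0\<close>.
\<close>

definition onorm_on ::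
  "'a::real_normed_vector set \<Rightarrow> ('a \<Rightarrow> 'b::real_normed_vector) \<Rightarrow> real" where
  "onorm_on Z T = (SUP x\<in>Z. norm (T x) / norm x)"

definition isomorphism_on ::
  "'a::real_normed_vector set \<Rightarrow> 'b::real_normed_vector set \<Rightarrow> ('a \<Rightarrow> 'b) \<Rightarrow> bool" where
  "isomorphism_on Z W T \<longleftrightarrow>
     bij_betw T Z W \<and> bounded_linear_on Z T \<and> bounded_linear_on W (inv_into Z T)"

text \<open>
  The infimum is taken in \<^typ>\<open>ereal\<close> so that the distance between non-isomorphic spaces is \<open>\<infinity>\<close>
  (an infimum of the empty set in \<^typ>\<open>real\<close> would be an unspecified number).
\<close>

definition banach_mazur_dist ::
  "'a::real_normed_vector set \<Rightarrow> 'b::real_normed_vector set \<Rightarrow> ereal" where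
  "banach_mazur_dist Z W =
     (INF T \<in> {T. isomorphism_on Z W T}. ereal (onorm_on Z T * onorm_on W (inv_into Z T)))"

text \<open>
  Since the dimension \<open>n\<close> has to vary inside formulas, \<open>\<real>\<^sup>n\<close> with the supremum norm is
  realised as the space of sequences supported on \<open>{..<n}\<close>, inside the library's space of bounded
  (trivially continuous) real functions on \<^typ>\<open>nat\<close> with the supremum norm. The two lemmas
  show that the coordinates range over all of \<open>\<real>\<^sup>n\<close> and that the norm is the expected one.
\<close>

definition linfty :: "nat \<Rightarrow> (nat \<Rightarrow>\<^sub>C real) set" where
  "linfty n = {f. \<forall>i\<ge>n. apply_bcontfun f i = 0}"

lemma linfty_coordinates: "\<exists>!f. f \<in> linfty n \<and> (\<forall>i<n. apply_bcontfun f i = x i)"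
proof -
  let ?g = "\<lambda>i. if i < n then x i else 0"
  have "range ?g \<subseteq> insert 0 (x ` {..<n})"
    by auto
  then have "finite (range ?g)"
    by (rule finite_subset) simp
  then have "?g \<in> bcontfun"
    by (auto simp: bcontfun_def continuous_on_discrete intro: finite_imp_bounded)
  then have app: "apply_bcontfun (Bcontfun ?g) = ?g"
    by (rule Bcontfun_inverse)
  show ?thesis
  proof (rule ex1I[of _ "Bcontfun ?g"])
    fix f assume f: "f \<in> linfty n \<and> (\<forall>i<n. apply_bcontfun f i = x i)"
    show "f = Bcontfun ?g"
      by (rule bcontfun_eqI) (use f in \<open>auto simp: app linfty_def\<close>)
  qed (auto simp: app linfty_def)
qed

lemma norm_linfty:
  assumes "f \<in> linfty n" "n > 0"
  shows "norm f = Max ((\<lambda>i. \<bar>apply_bcontfun f i\<bar>) ` {..<n})"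
proof (rule antisym)
  let ?A = "(\<lambda>i. \<bar>apply_bcontfun f i\<bar>) ` {..<n}"
  have ge: "\<bar>apply_bcontfun f i\<bar> \<le> Max ?A" if "i < n" for i
    using that by (intro Max_ge) auto
  have nonneg: "0 \<le> Max ?A"
    using order_trans[OF abs_ge_zero ge[OF assms(2)]] .
  show "norm f \<le> Max ?A"
  proof (rule norm_bound)
    fix i
    show "norm (apply_bcontfun f i) \<le> Max ?A"
      using ge[of i] nonneg assms(1) by (cases "i < n") (auto simp: linfty_def)
  qed
  show "Max ?A \<le> norm f"
    using assms(2) norm_bounded[of f] by (subst Max_le_iff) auto
qed

definition concave_metric :: "'a set \<Rightarrow> ('a \<Rightarrow> 'a \<Rightarrow> real) \<Rightarrow> bool" where
  "concave_metric M d \<longleftrightarrow>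
     (\<forall>x\<in>M. \<forall>y\<in>M. \<forall>z\<in>M. x \<noteq> y \<and> y \<noteq> z \<and> x \<noteq> z \<longrightarrow> d x y + d y z > d x z)"

end

(*
  Concavity makes every symmetric function v close to d a metric on Y, so the Frechet map
  x \<mapsto> (v(x, z))_z embeds (Y, v) isometrically into the sup-norm space of dimension card Y.
  Composed with an almost isometric embedding into X, it distorts v only slightly.  On the box
  of all v with d - \<eta> \<le> v \<le> d, each distance in X minus the corresponding d is therefore \<le> 0 on
  the lower face and \<ge> 0 on the upper face of its coordinate, and the Poincare-Miranda theorem
  yields a v for which all distances in X are exactly d.
*)

theory Submission
  imports Defs
begin

section \<open>The Poincare-Miranda theorem on cubes and boxes\<close>

lemma tendsto_coordinatewise_then_product:
  fixes f :: "'a \<Rightarrow> 'i \<Rightarrow> 'b::topological_space"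
  assumes "\<And>i. ((\<lambda>x. f x i) \<longlongrightarrow> l i) F"
  shows "(f \<longlongrightarrow> l) F"
  using assms limitin_componentwise[of "\<lambda>_. euclidean" UNIV f l F]
  by (simp add: euclidean_product_topology)

text \<open>
  The dimension \<open>n\<close> is the cardinality of a set and not of a type, so Brouwer's theorem for
  Euclidean spaces is not available; Kuhn's combinatorial lemma underlying it is. A grid point
  of the cube is labelled by the signs of the \<open>G i\<close>.
\<close>

lemma poincare_miranda_unit_cube:
  fixes G :: "nat \<Rightarrow> (nat \<Rightarrow> real) \<Rightarrow> real" and n :: nat
  defines "K \<equiv> Pi {..<n} (\<lambda>_. {0..1})"
  assumes cont: "\<And>i. i < n \<Longrightarrow> continuous_on K (G i)"
    and lower: "\<And>i x. i < n \<Longrightarrow> x \<in> K \<Longrightarrow> x i = 0 \<Longrightarrow> G i x \<le> 0"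
    and upper: "\<And>i x. i < n \<Longrightarrow> x \<in> K \<Longrightarrow> x i = 1 \<Longrightarrow> G i x \<ge> 0"
  shows "\<exists>x\<in>K. \<forall>i<n. G i x = 0"
proof -
  \<comment> \<open>Grid points of mesh \<open>1 / Suc p\<close>. The padding by \<open>0\<close>
    beyond \<open>n\<close> lets all of them lie in one compact set, as \<open>K\<close> leaves
    those coordinates free.\<close>
  define C where "C p q = (\<lambda>i. if i < n then real (q i) / real (Suc p) else 0)" for p q
  have C_K: "C p q \<in> K" if "\<forall>i<n. q i \<le> Suc p" for p q
    using that by (auto simp: C_def K_def)
  \<comment> \<open>Some grid cell, with lowest corner \<open>q\<close>, has for every
    \<open>i\<close> two corners at which \<open>G i\<close> takes opposite weak signs; the corners
    may depend on \<open>i\<close>.\<close>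
  have "\<exists>q. (\<forall>i<n. q i < Suc p) \<and> (\<forall>i<n. \<exists>r s. (\<forall>j<n. q j \<le> r j \<and> r j \<le> q j + 1) \<and>
      (\<forall>j<n. q j \<le> s j \<and> s j \<le> q j + 1) \<and> G i (C p r) \<le> 0 \<and> G i (C p s) \<ge> 0)" for p
  proof -
    \<comment> \<open>Kuhn's lemma prescribes label 0 on the face \<open>q i = 0\<close> and label 1
      on the face \<open>q i = Suc p\<close>. By \<open>lower\<close> and \<open>upper\<close> the
      prescribed labels still agree with the weak sign of \<open>G i\<close>.\<close>
    define l :: "(nat \<Rightarrow> nat) \<Rightarrow> nat \<Rightarrow> nat" where
      "l q i = (if q i = 0 then 0 else if q i = Suc p \<or> G i (C p q) > 0 then 1 else 0)" for q i
    have l0: "G i (C p q) \<le> 0" if "\<forall>i<n. q i \<le> Suc p" "i < n" "l q i = 0" for q i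
      using that lower[OF that(2) C_K[OF that(1)]] by (auto simp: l_def C_def split: if_splits)
    have l1: "G i (C p q) \<ge> 0" if "\<forall>i<n. q i \<le> Suc p" "i < n" "l q i \<noteq> 0" for q i
      using that upper[OF that(2) C_K[OF that(1)]]
      by (auto simp: l_def C_def simp del: of_nat_Suc split: if_splits)
    obtain q where q: "\<forall>i<n. q i < Suc p" and
      rs: "\<forall>i<n. \<exists>r s. (\<forall>j<n. q j \<le> r j \<and> r j \<le> q j + 1) \<and>
        (\<forall>j<n. q j \<le> s j \<and> s j \<le> q j + 1) \<and> l r i \<noteq> l s i"
      by (rule kuhn_lemma[of "Suc p" n l]) (auto simp: l_def)
    have "\<exists>r s. (\<forall>j<n. q j \<le> r j \<and> r j \<le> q j + 1) \<and>
      (\<forall>j<n. q j \<le> s j \<and> s j \<le> q j + 1) \<and> G i (C p r) \<le> 0 \<and> G i (C p s) \<ge> 0" if i: "i < n" for i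
    proof -
      obtain r s where r: "\<forall>j<n. q j \<le> r j \<and> r j \<le> q j + 1"
        and s: "\<forall>j<n. q j \<le> s j \<and> s j \<le> q j + 1" and ne: "l r i \<noteq> l s i"
        using rs i by blast
      have r': "\<forall>i<n. r i \<le> Suc p" and s': "\<forall>i<n. s i \<le> Suc p"
        using q r s by (metis Suc_eq_plus1 Suc_leI le_trans Suc_le_mono less_Suc_eq_le)+
      show ?thesis
      proof (cases "l r i = 0")
        case True
        then show ?thesis
          using l0[OF r' i] l1[OF s' i] ne r s by metis
      next
        case False
        then have "l s i = 0"
          using ne by (auto simp: l_def split: if_splits)
        then show ?thesis
          using l1[OF r' i False] l0[OF s' i] r s by metis
      qed
    qed
    then show ?thesis
      using q by blast
  qed
  then obtain q where q: "\<And>p i. i < n \<Longrightarrow> q p i < Suc p"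
    and "\<forall>p. \<forall>i<n. \<exists>r s. (\<forall>j<n. q p j \<le> r j \<and> r j \<le> q p j + 1) \<and>
      (\<forall>j<n. q p j \<le> s j \<and> s j \<le> q p j + 1) \<and> G i (C p r) \<le> 0 \<and> G i (C p s) \<ge> 0"
    by metis
  then obtain r s where r: "\<And>p i j. i < n \<Longrightarrow> j < n \<Longrightarrow> q p j \<le> r p i j \<and> r p i j \<le> q p j + 1"
    and s: "\<And>p i j. i < n \<Longrightarrow> j < n \<Longrightarrow> q p j \<le> s p i j \<and> s p i j \<le> q p j + 1"
    and Gr: "\<And>p i. i < n \<Longrightarrow> G i (C p (r p i)) \<le> 0"
    and Gs: "\<And>p i. i < n \<Longrightarrow> G i (C p (s p i)) \<ge> 0"
    by metis
  \<comment> \<open>Compact by Tychonoff, and sequentially compact because the index set is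
    countable.\<close>
  define K0 where "K0 = (PiE UNIV (\<lambda>i. if i < n then {0..1} else {0}) :: (nat \<Rightarrow> real) set)"
  have "compactin (product_topology (\<lambda>_. euclidean) UNIV) K0"
    unfolding K0_def compactin_PiE by (intro disjI2 ballI) simp
  then have "compact K0"
    by (simp add: euclidean_product_topology)
  moreover have "\<forall>p. C p (q p) \<in> K0"
    using q[THEN less_imp_le] by (auto simp: K0_def C_def simp del: of_nat_Suc)
  ultimately obtain x \<sigma> where x: "x \<in> K0" and \<sigma>: "strict_mono \<sigma>"
    and lim: "((\<lambda>p. C p (q p)) \<circ> \<sigma>) \<longlonglongrightarrow> x"
    using compact_imp_seq_compact seq_compactE by metis
  have xK: "x \<in> K"
    using x by (auto simp: K0_def K_def PiE_iff Pi_iff split: if_splits)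
  \<comment> \<open>The cells shrink, so any choice \<open>t\<close> of one corner per cell has the
    same limit \<open>x\<close> along \<open>\<sigma>\<close>. Applied to the nonpositive and to the
    nonnegative corners, this squeezes \<open>G i x\<close> to \<open>0\<close>.\<close>
  have step: "(\<lambda>p. G i (C (\<sigma> p) (t (\<sigma> p)))) \<longlonglongrightarrow> G i x"
    if i: "i < n" and t: "\<And>p j. j < n \<Longrightarrow> q p j \<le> t p j \<and> t p j \<le> q p j + 1" for i t
  proof -
    have "(\<lambda>p. C (\<sigma> p) (t (\<sigma> p)) j) \<longlonglongrightarrow> x j" for j
    proof (rule tendsto_sandwich)
      have l: "(\<lambda>p. C (\<sigma> p) (q (\<sigma> p)) j) \<longlonglongrightarrow> x j"
        using continuous_on_tendsto_compose[OF continuous_on_product_coordinates lim] by (simp add: o_def)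
      then show "(\<lambda>p. C (\<sigma> p) (q (\<sigma> p)) j) \<longlonglongrightarrow> x j" .
      have "(\<lambda>p. 1 / real (Suc p)) \<longlonglongrightarrow> 0"
        by (rule LIMSEQ_Suc[OF lim_1_over_n])
      from tendsto_add[OF l LIMSEQ_subseq_LIMSEQ[OF this \<sigma>]]
      show "(\<lambda>p. C (\<sigma> p) (q (\<sigma> p)) j + 1 / real (Suc (\<sigma> p))) \<longlonglongrightarrow> x j"
        by (simp add: o_def)
      have "C p (q p) j \<le> C p (t p) j \<and> C p (t p) j \<le> C p (q p) j + 1 / real (Suc p)" for p
        using t[of j p] by (auto simp: C_def divide_simps)
      then show "\<forall>\<^sub>F p in sequentially. C (\<sigma> p) (q (\<sigma> p)) j \<le> C (\<sigma> p) (t (\<sigma> p)) j"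
        "\<forall>\<^sub>F p in sequentially. C (\<sigma> p) (t (\<sigma> p)) j
          \<le> C (\<sigma> p) (q (\<sigma> p)) j + 1 / real (Suc (\<sigma> p))"
        by auto
    qed
    then have "(\<lambda>p. C (\<sigma> p) (t (\<sigma> p))) \<longlonglongrightarrow> x"
      by (rule tendsto_coordinatewise_then_product)
    moreover have "C p (t p) \<in> K" for p
    proof (rule C_K, intro allI impI)
      fix j assume "j < n"
      then show "t p j \<le> Suc p"
        using q[of j p] t[of j p] by linarith
    qed
    ultimately show ?thesis
      by (intro continuous_on_tendsto_compose[OF cont[OF i] _ xK]) auto
  qed
  have "G i x = 0" if i: "i < n" for i
  proof (rule antisym)
    show "G i x \<le> 0"
      using step[OF i, of "\<lambda>p. r p i"] r Gr i by (intro LIMSEQ_le_const2) auto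
    show "0 \<le> G i x"
      using step[OF i, of "\<lambda>p. s p i"] s Gs i by (intro LIMSEQ_le_const) auto
  qed
  then show ?thesis
    using xK by blast
qed

text \<open>Numbering \<open>I\<close> and rescaling each side affinely reduces this to the unit
  cube. Only the map from the cube to the box is used, never its inverse, so sides may degenerate to
  points.\<close>

lemma poincare_miranda:
  fixes G :: "'i \<Rightarrow> ('i \<Rightarrow> real) \<Rightarrow> real" and a b :: "'i \<Rightarrow> real" and I :: "'i set"
  defines "B \<equiv> Pi I (\<lambda>i. {a i..b i})"
  assumes fin: "finite I" and ab: "\<And>i. i \<in> I \<Longrightarrow> a i \<le> b i"
    and cont: "\<And>i. i \<in> I \<Longrightarrow> continuous_on B (G i)"
    and lower: "\<And>i x. i \<in> I \<Longrightarrow> x \<in> B \<Longrightarrow> x i = a i \<Longrightarrow> G i x \<le> 0"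
    and upper: "\<And>i x. i \<in> I \<Longrightarrow> x \<in> B \<Longrightarrow> x i = b i \<Longrightarrow> G i x \<ge> 0"
  shows "\<exists>x\<in>B. \<forall>i\<in>I. G i x = 0"
proof -
  obtain e where e: "bij_betw e I {..<card I}"
    using ex_bij_betw_finite_nat[OF fin] by (auto simp: atLeast0LessThan)
  define \<phi> where "\<phi> t i = a i + t (e i) * (b i - a i)" for t :: "nat \<Rightarrow> real" and i
  have e_less: "e i < card I" if "i \<in> I" for i
    using e that by (auto simp: bij_betw_def)
  have \<phi>B: "\<phi> t \<in> B" if "t \<in> Pi {..<card I} (\<lambda>_. {0..1})" for t
  proof -
    have "0 \<le> t (e i) * (b i - a i)" "t (e i) * (b i - a i) \<le> b i - a i" if i: "i \<in> I" for i
      using \<open>t \<in> _\<close> e_less[OF i] ab[OF i] by (auto simp: Pi_iff intro: mult_left_le_one_le)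
    then show ?thesis
      by (fastforce simp: B_def \<phi>_def)
  qed
  let ?e' = "inv_into I e"
  have e': "?e' k \<in> I" "e (?e' k) = k" if "k < card I" for k
    using that e by (auto simp: bij_betw_def inv_into_into f_inv_into_f)
  have "\<exists>t\<in>Pi {..<card I} (\<lambda>_. {0..1}). \<forall>k<card I. G (?e' k) (\<phi> t) = 0"
  proof (rule poincare_miranda_unit_cube)
    fix k assume k: "k < card I"
    have "continuous_on S \<phi>" for S
      unfolding \<phi>_def
      by (intro continuous_intros continuous_on_subset[OF continuous_on_product_coordinates]) auto
    then show "continuous_on (Pi {..<card I} (\<lambda>_. {0..1})) (\<lambda>t. G (?e' k) (\<phi> t))"
      by (rule continuous_on_compose2[OF cont[OF e'(1)[OF k]]]) (use \<phi>B in auto)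
    fix t :: "nat \<Rightarrow> real" assume t: "t \<in> Pi {..<card I} (\<lambda>_. {0..1})"
    show "G (?e' k) (\<phi> t) \<le> 0" if "t k = 0"
      using lower[OF e'(1)[OF k] \<phi>B[OF t]] that e'(2)[OF k] by (simp add: \<phi>_def)
    show "G (?e' k) (\<phi> t) \<ge> 0" if "t k = 1"
      using upper[OF e'(1)[OF k] \<phi>B[OF t]] that e'(2)[OF k] by (simp add: \<phi>_def)
  qed
  then obtain t where t: "t \<in> Pi {..<card I} (\<lambda>_. {0..1})"
    and G0: "\<And>k. k < card I \<Longrightarrow> G (?e' k) (\<phi> t) = 0"
    by blast
  have "G i (\<phi> t) = 0" if i: "i \<in> I" for i
    using G0[OF e_less[OF i]] e i by (simp add: bij_betw_def)
  then show ?thesis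
    using \<phi>B[OF t] by blast
qed

section \<open>Operator norms and the Banach-Mazur distance\<close>

lemma norm_le_onorm_on:
  assumes "bounded_linear_on Z T" "x \<in> Z"
  shows "norm (T x) \<le> onorm_on Z T * norm x"
proof -
  obtain K where K: "\<And>x. x \<in> Z \<Longrightarrow> norm (T x) \<le> norm x * K"
    using assms(1) unfolding bounded_linear_on_def by blast
  show ?thesis
  proof (cases "x = 0")
    case True
    then show ?thesis using K[OF assms(2)] by simp
  next
    case False
    have "bdd_above ((\<lambda>x. norm (T x) / norm x) ` Z)"
    proof (rule bdd_aboveI2)
      fix y assume "y \<in> Z"
      \<comment> \<open>\<open>K\<close> may be negative if \<open>Z\<close> is trivial, while the
        quotient at \<open>0\<close> is \<open>0\<close>; hence the absolute value.\<close>
      from K[OF this] show "norm (T y) / norm y \<le> \<bar>K\<bar>"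
        by (cases "y = 0") (auto simp: divide_simps mult.commute intro: order_trans mult_left_mono)
    qed
    then have "norm (T x) / norm x \<le> onorm_on Z T"
      unfolding onorm_on_def by (rule cSUP_upper[OF assms(2)])
    then show ?thesis using False by (simp add: divide_simps)
  qed
qed

text \<open>Take an isomorphism \<open>T\<close> whose norm product is below \<open>c\<close> and
  let \<open>S\<close> be its inverse scaled by the norm of \<open>T\<close>. This normalisation
  makes \<open>S\<close> noncontracting and leaves all of the distortion to the upper bound.\<close>

lemma banach_mazur_dist_less_imp_embedding:
  fixes Z :: "'a::real_normed_vector set" and W :: "'b::real_normed_vector set"
  assumes "banach_mazur_dist Z W < ereal c" "w\<^sub>0 \<in> W" "w\<^sub>0 \<noteq> 0"
  obtains S :: "'b \<Rightarrow> 'a" where "bounded_linear_on W S" "\<And>w. w \<in> W \<Longrightarrow> norm w \<le> norm (S w)"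
    "\<And>w. w \<in> W \<Longrightarrow> norm (S w) \<le> c * norm w"
proof -
  obtain T where bij: "bij_betw T Z W" and T: "bounded_linear_on Z T"
    and T': "bounded_linear_on W (inv_into Z T)"
    and c: "onorm_on Z T * onorm_on W (inv_into Z T) < c"
    using assms(1) by (auto simp: banach_mazur_dist_def INF_less_iff isomorphism_on_def)
  let ?T' = "inv_into Z T" and ?a = "onorm_on Z T"
  have inv: "?T' w \<in> Z" "T (?T' w) = w" if "w \<in> W" for w
    using bij that by (auto simp: bij_betw_def inv_into_into f_inv_into_f)
  have le: "norm w \<le> ?a * norm (?T' w)" if "w \<in> W" for w
    using norm_le_onorm_on[OF T inv(1)[OF that]] inv(2)[OF that] by simp
  \<comment> \<open>The nonzero vector fixes the sign of \<open>?a\<close>, so that the factor can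
    be pulled out of norms.\<close>
  have "0 < ?a * norm (?T' w\<^sub>0)"
    by (rule less_le_trans[OF _ le[OF assms(2)]]) (use assms(3) in simp)
  then have a: "0 \<le> ?a"
    by (simp add: zero_less_mult_iff)
  show thesis
  proof (rule that[of "\<lambda>w. ?a *\<^sub>R ?T' w"])
    obtain K where K: "\<And>w. w \<in> W \<Longrightarrow> norm (?T' w) \<le> norm w * K"
      using T' unfolding bounded_linear_on_def by blast
    show "bounded_linear_on W (\<lambda>w. ?a *\<^sub>R ?T' w)"
      using T' a unfolding bounded_linear_on_def
      by (auto simp: scaleR_add_right intro!: exI[of _ "?a * K"])
         (metis K mult_left_mono mult.left_commute)
    fix w assume w: "w \<in> W"
    show "norm w \<le> norm (?a *\<^sub>R ?T' w)"
      using le[OF w] a by simp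
    have "?a * norm (?T' w) \<le> ?a * (onorm_on W ?T' * norm w)"
      using norm_le_onorm_on[OF T' w] a by (rule mult_left_mono)
    also have "\<dots> \<le> c * norm w"
      using c mult_right_mono[of "?a * onorm_on W ?T'" c "norm w"] by simp
    finally show "norm (?a *\<^sub>R ?T' w) \<le> c * norm w"
      using a by simp
  qed
qed

section \<open>Bases with nearly the sup norm, indexed by a finite set\<close>

lemma bounded_linear_on_sum:
  assumes "bounded_linear_on W S" "subspace W" "\<And>z. z \<in> Y \<Longrightarrow> u z \<in> W"
  shows "S (\<Sum>z\<in>Y. c z *\<^sub>R u z) = (\<Sum>z\<in>Y. c z *\<^sub>R S (u z))"
  using assms(3)
proof (induction Y rule: infinite_finite_induct)
  case (insert z Y)
  then have "(\<Sum>z\<in>Y. c z *\<^sub>R u z) \<in> W" "u z \<in> W"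
    by (auto intro!: subspace_sum subspace_scale assms(2))
  then show ?case
    using insert assms(1) subspace_scale[OF assms(2)] by (simp add: bounded_linear_on_def)
qed (use assms(1) subspace_0[OF assms(2)] in \<open>force simp: bounded_linear_on_def\<close>)+

lemma subspace_linfty: "subspace (linfty n)"
  by (auto simp: subspace_def linfty_def)

text \<open>The \<open>u y\<close> are the standard unit vectors, indexed by \<open>Y\<close>
  through a bijection. Together the two estimates say that the norm of a combination is the largest
  absolute coefficient; with a bound \<open>t \<ge> 0\<close> instead of a maximum, empty
  \<open>Y\<close> is covered as well.\<close>

lemma linfty_basis:
  assumes "finite Y"
  obtains u :: "'y \<Rightarrow> nat \<Rightarrow>\<^sub>C real" where "\<And>y. y \<in> Y \<Longrightarrow> u y \<in> linfty (card Y)"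
    "\<And>c y. y \<in> Y \<Longrightarrow> \<bar>c y\<bar> \<le> norm (\<Sum>z\<in>Y. c z *\<^sub>R u z)"
    "\<And>c t. 0 \<le> t \<Longrightarrow> (\<And>y. y \<in> Y \<Longrightarrow> \<bar>c y\<bar> \<le> t) \<Longrightarrow> norm (\<Sum>z\<in>Y. c z *\<^sub>R u z) \<le> t"
proof -
  obtain e where e: "bij_betw e Y {..<card Y}"
    using ex_bij_betw_finite_nat[OF assms] by (auto simp: atLeast0LessThan)
  define \<delta> where "\<delta> y i = (if i = e y \<and> i < card Y then 1 else 0 :: real)" for y i
  obtain u where u: "\<And>y. u y \<in> linfty (card Y)" "\<And>y i. i < card Y \<Longrightarrow> apply_bcontfun (u y) i = \<delta> y i"
    using linfty_coordinates[of "card Y" "\<delta> _"] by metis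
  have app: "apply_bcontfun (\<Sum>z\<in>A. c z *\<^sub>R u z) i = (\<Sum>z\<in>A. c z * apply_bcontfun (u z) i)" for A c i
    by (induction A rule: infinite_finite_induct) auto
  have coord: "apply_bcontfun (\<Sum>z\<in>Y. c z *\<^sub>R u z) (e y) = c y" if y: "y \<in> Y" for c y
  proof -
    have "e y < card Y" using e y by (auto simp: bij_betw_def)
    then have "(\<Sum>z\<in>Y. c z * apply_bcontfun (u z) (e y)) = (\<Sum>z\<in>Y. if z = y then c z else 0)"
      using e y by (intro sum.cong) (auto simp: u \<delta>_def bij_betw_def inj_on_def)
    then show ?thesis using y assms by (simp add: app)
  qed
  show thesis
  proof
    fix c :: "'y \<Rightarrow> real" and y assume "y \<in> Y"
    then show "\<bar>c y\<bar> \<le> norm (\<Sum>z\<in>Y. c z *\<^sub>R u z)"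
      using norm_bounded[of "\<Sum>z\<in>Y. c z *\<^sub>R u z" "e y"] coord by simp
  next
    fix c :: "'y \<Rightarrow> real" and t :: real assume t: "0 \<le> t" "\<And>y. y \<in> Y \<Longrightarrow> \<bar>c y\<bar> \<le> t"
    have mem: "(\<Sum>z\<in>Y. c z *\<^sub>R u z) \<in> linfty (card Y)"
      by (intro subspace_sum subspace_scale subspace_linfty u)
    show "norm (\<Sum>z\<in>Y. c z *\<^sub>R u z) \<le> t"
    proof (rule norm_bound)
      fix i
      show "norm (apply_bcontfun (\<Sum>z\<in>Y. c z *\<^sub>R u z) i) \<le> t"
      proof (cases "i < card Y")
        case True
        then obtain y where "y \<in> Y" "i = e y"
          using e by (auto simp: bij_betw_def)
        then show ?thesis using coord t by simp
      next
        case False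
        then show ?thesis using mem t by (simp add: linfty_def)
      qed
    qed
  qed (rule u)
qed

text \<open>The \<open>P y\<close> are the images of the unit vectors under an almost isometric
  embedding. Later estimates then involve only coefficient families on \<open>Y\<close>.\<close>

lemma almost_linfty_basis:
  fixes Y :: "'y set" and Z :: "'x::real_normed_vector set"
  assumes "finite Y" "Y \<noteq> {}" "banach_mazur_dist Z (linfty (card Y)) < ereal k"
  obtains P :: "'y \<Rightarrow> 'x" where
    "\<And>c y. y \<in> Y \<Longrightarrow> \<bar>c y\<bar> \<le> norm (\<Sum>z\<in>Y. c z *\<^sub>R P z)"
    "\<And>c t. 0 \<le> t \<Longrightarrow> (\<And>y. y \<in> Y \<Longrightarrow> \<bar>c y\<bar> \<le> t) \<Longrightarrow> norm (\<Sum>z\<in>Y. c z *\<^sub>R P z) \<le> k * t"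
proof -
  obtain u :: "'y \<Rightarrow> nat \<Rightarrow>\<^sub>C real" where u: "\<And>y. y \<in> Y \<Longrightarrow> u y \<in> linfty (card Y)"
    and ge: "\<And>c y. y \<in> Y \<Longrightarrow> \<bar>c y\<bar> \<le> norm (\<Sum>z\<in>Y. c z *\<^sub>R u z)"
    and le: "\<And>c t. 0 \<le> t \<Longrightarrow> (\<And>y. y \<in> Y \<Longrightarrow> \<bar>c y\<bar> \<le> t) \<Longrightarrow> norm (\<Sum>z\<in>Y. c z *\<^sub>R u z) \<le> t"
    using linfty_basis[OF assms(1)] by blast
  let ?v = "\<lambda>c. \<Sum>z\<in>Y. c z *\<^sub>R u z"
  have v: "?v c \<in> linfty (card Y)" for c
    by (intro subspace_sum subspace_scale subspace_linfty u)
  obtain y where y: "y \<in> Y" using assms(2) by blast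
  \<comment> \<open>The all-ones vector serves as the nonzero vector of the embedding lemma; it is
    nonzero since \<open>Y\<close> has a point.\<close>
  have nz: "?v (\<lambda>_. 1) \<noteq> 0"
    using ge[OF y, of "\<lambda>_. 1"] by auto
  obtain S :: "(nat \<Rightarrow>\<^sub>C real) \<Rightarrow> 'x" where S: "bounded_linear_on (linfty (card Y)) S"
    and S1: "\<And>w. w \<in> linfty (card Y) \<Longrightarrow> norm w \<le> norm (S w)"
    and S2: "\<And>w. w \<in> linfty (card Y) \<Longrightarrow> norm (S w) \<le> k * norm w"
    by (rule banach_mazur_dist_less_imp_embedding[OF assms(3) v nz]) blast
  have "0 < k * norm (?v (\<lambda>_. 1))"
    by (rule less_le_trans[OF _ order_trans[OF S1[OF v] S2[OF v]]]) (use nz in simp)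
  then have k: "0 \<le> k"
    by (simp add: zero_less_mult_iff)
  have eq: "(\<Sum>z\<in>Y. c z *\<^sub>R S (u z)) = S (?v c)" for c
    using bounded_linear_on_sum[OF S subspace_linfty, of Y u] u by simp
  show thesis
  proof (rule that[of "\<lambda>z. S (u z)"])
    show "\<bar>c y\<bar> \<le> norm (\<Sum>z\<in>Y. c z *\<^sub>R S (u z))" if "y \<in> Y" for c y
      using order_trans[OF ge[OF that] S1[OF v]] by (simp add: eq)
    show "norm (\<Sum>z\<in>Y. c z *\<^sub>R S (u z)) \<le> k * t"
      if "0 \<le> t" "\<And>y. y \<in> Y \<Longrightarrow> \<bar>c y\<bar> \<le> t" for c t
      using order_trans[OF S2[OF v] mult_left_mono[OF le[OF that] k]] by (simp add: eq)
  qed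
qed

section \<open>Uniform strictness of a finite concave metric\<close>

text \<open>Each of the finitely many strict inequalities holds with room \<open>\<eta>\<close> for
  all small \<open>\<eta> > 0\<close>, hence all do for a common one. The factor 2 allows both
  distances on the right to shrink by \<open>\<eta>\<close> while the left one does not
  grow.\<close>

lemma concave_metric_gap:
  assumes "Metric_space Y d" "finite Y" "concave_metric Y d"
  obtains \<eta> where "\<eta> > 0" "\<And>x y. x \<in> Y \<Longrightarrow> y \<in> Y \<Longrightarrow> x \<noteq> y \<Longrightarrow> \<eta> \<le> d x y"
    "\<And>x y z. x \<in> Y \<Longrightarrow> y \<in> Y \<Longrightarrow> z \<in> Y \<Longrightarrow> x \<noteq> y \<Longrightarrow> y \<noteq> z \<Longrightarrow> x \<noteq> z \<Longrightarrow>
      d x z + 2 * \<eta> \<le> d x y + d y z"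
proof -
  interpret Metric_space Y d by fact
  have 1: "\<forall>\<^sub>F \<eta> in at_right 0. x \<noteq> y \<longrightarrow> \<eta> \<le> d x y" if "x \<in> Y" "y \<in> Y" for x y
  proof (cases "x = y")
    case False
    then have "d x y > 0" using that mdist_pos_less by blast
    then show ?thesis
      by (auto simp: eventually_at_right_field intro!: exI[of _ "d x y"])
  qed auto
  have 2: "\<forall>\<^sub>F \<eta> in at_right 0. x \<noteq> y \<longrightarrow> y \<noteq> z \<longrightarrow> x \<noteq> z \<longrightarrow> d x z + 2 * \<eta> \<le> d x y + d y z"
    if "x \<in> Y" "y \<in> Y" "z \<in> Y" for x y z
  proof (cases "x \<noteq> y \<and> y \<noteq> z \<and> x \<noteq> z")
    case True
    then have "d x y + d y z - d x z > 0"
      using assms(3) that by (auto simp: concave_metric_def)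
    then show ?thesis
      by (auto simp: eventually_at_right_field intro!: exI[of _ "(d x y + d y z - d x z) / 2"])
  qed auto
  have "\<forall>\<^sub>F \<eta> in at_right 0. \<eta> > 0 \<and> (\<forall>x\<in>Y. \<forall>y\<in>Y. x \<noteq> y \<longrightarrow> \<eta> \<le> d x y) \<and>
    (\<forall>x\<in>Y. \<forall>y\<in>Y. \<forall>z\<in>Y. x \<noteq> y \<longrightarrow> y \<noteq> z \<longrightarrow> x \<noteq> z \<longrightarrow> d x z + 2 * \<eta> \<le> d x y + d y z)"
    by (intro eventually_conj eventually_ball_finite ballI assms(2) 1 2 eventually_at_right_less)
  from eventually_happens'[OF trivial_limit_at_right_real this]
  obtain \<eta> :: real where \<eta>: "\<eta> > 0" "\<forall>x\<in>Y. \<forall>y\<in>Y. x \<noteq> y \<longrightarrow> \<eta> \<le> d x y"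
    "\<forall>x\<in>Y. \<forall>y\<in>Y. \<forall>z\<in>Y. x \<noteq> y \<longrightarrow> y \<noteq> z \<longrightarrow> x \<noteq> z \<longrightarrow> d x z + 2 * \<eta> \<le> d x y + d y z"
    by (elim exE conjE)
  show thesis
    by (rule that[OF \<eta>(1)]) (simp_all add: \<eta>(2,3))
qed

section \<open>The isometric embedding\<close>

theorem theorem4p3:
  fixes Y :: "'y set" and d :: "'y \<Rightarrow> 'y \<Rightarrow> real"
  assumes "\<forall>n::nat. \<forall>\<epsilon>::real. \<epsilon> > 0 \<longrightarrow>
             (\<exists>Z :: 'x::banach set. subspace Z \<and> banach_mazur_dist Z (linfty n) \<le> ereal (1 + \<epsilon>))"
    and "Metric_space Y d"
    and "finite Y"
    and "concave_metric Y d"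
  shows "\<exists>f :: 'y \<Rightarrow> 'x. \<forall>y\<in>Y. \<forall>z\<in>Y. dist (f y) (f z) = d y z"
proof (cases "Y = {}")
  case False
  interpret Metric_space Y d by fact
  obtain \<eta> where \<eta>: "\<eta> > 0" "\<And>x y. x \<in> Y \<Longrightarrow> y \<in> Y \<Longrightarrow> x \<noteq> y \<Longrightarrow> \<eta> \<le> d x y"
    and gap: "\<And>x y z. x \<in> Y \<Longrightarrow> y \<in> Y \<Longrightarrow> z \<in> Y \<Longrightarrow> x \<noteq> y \<Longrightarrow> y \<noteq> z \<Longrightarrow> x \<noteq> z \<Longrightarrow>
      d x z + 2 * \<eta> \<le> d x y + d y z"
    using concave_metric_gap[OF assms(2-4)] by blast
  define D where "D = (\<Sum>x\<in>Y. \<Sum>y\<in>Y. d x y)"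
  have dD: "d x y \<le> D" if "x \<in> Y" "y \<in> Y" for x y
  proof -
    have "d x y \<le> (\<Sum>y\<in>Y. d x y)"
      using that assms(3) by (intro member_le_sum) auto
    also have "\<dots> \<le> D"
      unfolding D_def using that assms(3) by (intro member_le_sum) (auto intro: sum_nonneg)
    finally show ?thesis .
  qed
  have D: "D \<ge> 0" by (auto simp: D_def intro!: sum_nonneg)
  \<comment> \<open>At distances up to \<open>D\<close> a relative error \<open>\<epsilon>\<close>
    costs at most \<open>\<eta>\<close>, the height of the box below. The summand 1 keeps the
    denominator positive when \<open>Y\<close> is a single point.\<close>
  define \<epsilon> where "\<epsilon> = \<eta> / (D + 1)"
  have \<epsilon>: "\<epsilon> > 0" "\<epsilon> * D \<le> \<eta>"
    using \<eta>(1) D by (auto simp: \<epsilon>_def divide_simps)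
  \<comment> \<open>Half of \<open>\<epsilon>\<close> turns the weak bound of the hypothesis into
    the strict one required for \<open>P\<close>.\<close>
  obtain Z :: "'x set" where "banach_mazur_dist Z (linfty (card Y)) \<le> ereal (1 + \<epsilon> / 2)"
    using assms(1) \<epsilon>(1) by (metis half_gt_zero)
  then have "banach_mazur_dist Z (linfty (card Y)) < ereal (1 + \<epsilon>)"
    using \<epsilon>(1) by (elim le_less_trans) simp
  then obtain P :: "'y \<Rightarrow> 'x" where
    ge: "\<And>c y. y \<in> Y \<Longrightarrow> \<bar>c y\<bar> \<le> norm (\<Sum>z\<in>Y. c z *\<^sub>R P z)" and
    le: "\<And>c t. 0 \<le> t \<Longrightarrow> (\<And>y. y \<in> Y \<Longrightarrow> \<bar>c y\<bar> \<le> t) \<Longrightarrow> norm (\<Sum>z\<in>Y. c z *\<^sub>R P z) \<le> (1 + \<epsilon>) * t"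
    using almost_linfty_basis[OF assms(3) False] by blast

  \<comment> \<open>Candidate metrics are indexed by unordered pairs, so that symmetry is automatic.\<close>
  define I where "I = {{x, y} | x y. x \<in> Y \<and> y \<in> Y \<and> x \<noteq> y}"
  define \<rho> where "\<rho> v x y = (if x = y then 0 else v {x, y})" for v :: "'y set \<Rightarrow> real" and x y
  \<comment> \<open>The Frechet map of \<open>\<rho> v\<close>, with \<open>P\<close> in place of
    the unit vectors.\<close>
  define f where "f v x = (\<Sum>z\<in>Y. \<rho> v x z *\<^sub>R P z)" for v x
  \<comment> \<open>The choices in \<open>d'\<close> and \<open>N\<close> do not depend on the order
    of the pair, by symmetry of \<open>d\<close> and \<open>dist\<close>.\<close>
  define d' where "d' p = (SOME t. \<exists>x y. p = {x, y} \<and> t = d x y)" for p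
  define N where "N p v = (SOME t. \<exists>x y. p = {x, y} \<and> t = dist (f v x) (f v y))" for p v
  have d': "d' {x, y} = d x y" for x y
    unfolding d'_def by (rule some_equality) (auto simp: doubleton_eq_iff commute)
  have N: "N {x, y} v = dist (f v x) (f v y)" for x y v
    unfolding N_def by (rule some_equality) (auto simp: doubleton_eq_iff dist_commute)
  let ?B = "Pi I (\<lambda>p. {d' p - \<eta>..d' p})"
  have bounds: "\<rho> v x y \<le> N {x, y} v \<and> N {x, y} v \<le> (1 + \<epsilon>) * \<rho> v x y"
    if v: "v \<in> ?B" and xy: "x \<in> Y" "y \<in> Y" for v x y
  proof -
    have \<rho>: "d x y - \<eta> \<le> \<rho> v x y" "\<rho> v x y \<le> d x y" "0 \<le> \<rho> v x y" "\<rho> v y x = \<rho> v x y"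
      if "x \<in> Y" "y \<in> Y" for x y
    proof -
      have "d' {x, y} - \<eta> \<le> v {x, y} \<and> v {x, y} \<le> d' {x, y}" if "x \<noteq> y"
        using v \<open>x \<in> Y\<close> \<open>y \<in> Y\<close> that by (fastforce simp: I_def)
      then show "d x y - \<eta> \<le> \<rho> v x y" "\<rho> v x y \<le> d x y" "0 \<le> \<rho> v x y" "\<rho> v y x = \<rho> v x y"
        using \<eta>(1) \<eta>(2)[OF that] that by (auto simp: \<rho>_def d' insert_commute)
    qed
    \<comment> \<open>For distinct points, \<open>\<rho> v x z\<close> is at most
      \<open>d x z\<close>, and the gap \<open>2 * \<eta>\<close> absorbs the loss of
      \<open>\<eta>\<close> in each of the other two distances.\<close>
    have tri: "\<rho> v x z \<le> \<rho> v x y + \<rho> v y z" if "x \<in> Y" "y \<in> Y" "z \<in> Y" for x y z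
    proof (cases "x \<noteq> y \<and> y \<noteq> z \<and> x \<noteq> z")
      case True
      then show ?thesis
        using gap[OF that] \<rho>(2)[OF that(1,3)] \<rho>(1)[OF that(1,2)] \<rho>(1)[OF that(2,3)] by linarith
    next
      case False
      then show ?thesis
        using \<rho>(3)[OF that(1,2)] \<rho>(3)[OF that(2,3)] by (auto simp: \<rho>_def)
    qed
    have eq: "N {x, y} v = norm (\<Sum>z\<in>Y. (\<rho> v x z - \<rho> v y z) *\<^sub>R P z)"
      by (simp add: N dist_norm f_def scaleR_diff_left sum_subtractf)
    \<comment> \<open>The triangle inequality bounds every coefficient of the difference by
      \<open>\<rho> v x y\<close>; below, the coefficient at \<open>z = y\<close> attains this
      value.\<close>
    have "\<bar>\<rho> v x z - \<rho> v y z\<bar> \<le> \<rho> v x y" if "z \<in> Y" for z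
      using tri[OF xy that] tri[OF xy(2,1) that] \<rho>(4)[OF xy] by linarith
    from le[OF \<rho>(3)[OF xy] this] have "N {x, y} v \<le> (1 + \<epsilon>) * \<rho> v x y"
      by (simp add: eq)
    moreover have "\<rho> v x y \<le> N {x, y} v"
      using ge[OF xy(2), of "\<lambda>z. \<rho> v x z - \<rho> v y z"] by (simp add: eq \<rho>_def)
    ultimately show ?thesis by simp
  qed
  have "\<exists>v\<in>?B. \<forall>p\<in>I. N p v - d' p = 0"
  proof (rule poincare_miranda)
    have "I \<subseteq> Pow Y" by (auto simp: I_def)
    then show "finite I"
      using assms(3) by (meson finite_Pow_iff finite_subset)
    fix p assume p: "p \<in> I"
    then obtain x y where xy: "p = {x, y}" "x \<in> Y" "y \<in> Y" "x \<noteq> y"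
      by (auto simp: I_def)
    show "d' p - \<eta> \<le> d' p"
      using \<eta>(1) by simp
    have "continuous_on ?B (\<lambda>v. \<rho> v x z)" for x z
      unfolding \<rho>_def
      by (cases "x = z") (auto intro: continuous_on_subset[OF continuous_on_product_coordinates])
    then show "continuous_on ?B (\<lambda>v. N p v - d' p)"
      unfolding xy N f_def by (intro continuous_intros)
    fix v assume v: "v \<in> ?B"
    have \<rho>: "\<rho> v x y = v p"
      using xy by (simp add: \<rho>_def)
    \<comment> \<open>On the upper face \<open>\<rho> v x y\<close> equals \<open>d x y\<close>, and
      the embedding does not contract.\<close>
    show "N p v - d' p \<ge> 0" if "v p = d' p"
      using bounds[OF v xy(2,3)] that by (simp add: xy(1) \<rho>[unfolded xy(1)])
    show "N p v - d' p \<le> 0" if "v p = d' p - \<eta>"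
    proof -
      have "N p v \<le> (1 + \<epsilon>) * (d x y - \<eta>)"
        using bounds[OF v xy(2,3)] that by (simp add: xy(1) \<rho>[unfolded xy(1)] d')
      also have "\<dots> \<le> d x y"
      proof -
        \<comment> \<open>On the lower face the expansion regains at most
          \<open>\<epsilon> * D \<le> \<eta>\<close>, so it cannot exceed
          \<open>d x y\<close>.\<close>
        have "\<epsilon> * (d x y - \<eta>) \<le> \<epsilon> * D"
          using \<epsilon>(1) \<eta>(1) dD[OF xy(2,3)] by (intro mult_left_mono) auto
        then show ?thesis
          using \<epsilon>(2) by (simp add: algebra_simps)
      qed
      finally show ?thesis
        by (simp add: xy(1) d')
    qed
  qed
  then obtain v where v: "\<And>p. p \<in> I \<Longrightarrow> N p v = d' p"
    by auto
  have "dist (f v x) (f v y) = d x y" if "x \<in> Y" "y \<in> Y" for x y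
  proof (cases "x = y")
    case False
    then have "{x, y} \<in> I" using that by (auto simp: I_def)
    from v[OF this] show ?thesis by (simp add: N d')
  qed (use that in simp)
  then show ?thesis
    by blast
qed simp

end
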